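(* For every set partition $\phi$ of $[n]$, \[ p_\phi=\sum_{\Phi:\ \mathsf{sort}(\Phi)=\phi}P_\Phi , \] where the sum is over all set compositions $\Phi$ whose blocks, forgetting their order, form $\phi$.
   Context: Notation: $x_1,x_2,\dots$ are non-commuting variables. For a word $w=w_1\cdots w_n$ of positive integers, write $x_w=x_{w_1}\cdots x_{w_n}$. Power sums in $\mathrm{NCSym}$: for a set partition $\phi$ of $[n]$, $p_\phi=\sum x_w$, summed over words $w$ of length $n$ such that $w_j=w_k$ whenever $j,k$ lie in the same block of $\phi$. Set compositions: a set composition $\Phi=B_1|\cdots|B_k$ of $n$ is a sequence of nonempty pairwise disjoint sets with union $[n]$. Monomial basis of $\mathrm{NCQSym}$: for a word $w$ of length $n$ with distinct values $v_1<\dots<v_k$, let $\varrho(w)=B_1|\cdots|B_k$, where $B_j=\{i:w_i=v_j\}$. Then $M_\Phi=\sum_{w:\varrho(w)=\Phi}x_w$. Order on blocks: for disjoint sets $A,B$, write $A>_{\mathcal D}B$ if either $|A|>|B|$, or $|A|=|B|$ and $\min A<\min B$. LDD fillings: an LDD filling of $\Phi=B_1|\cdots|B_k$ is a placement of block $B_i$ in row $i$ of a matrix (one block per row, other entries empty) such that the following hold. - $B_1$ is in column 1. - For each $i$: if $B_i>_{\mathcal D}B_{i+1}$, then $B_{i+1}$ is in the same column as $B_i$ or in the next column; otherwise $B_{i+1}$ is in the next column. $\mathsf{LDD}(\Phi)$ is the set of such fillings. The column reading $\mathsf{col}(\tilde{\mathsf F})$ is the set composition listing, left to right, the union of the blocks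 in each nonempty column. The power sum basis of $\mathrm{NCQSym}$ is $P_\Phi=\sum_{\tilde{\mathsf F}\in\mathsf{LDD}(\Phi)}M_{\mathsf{col}(\tilde{\mathsf F})}$. *)

theory Defs
  imports Main "HOL-Library.Disjoint_Sets" "HOL-Library.Function_Algebras"
begin

text \<open>
  Formal power series in the non-commuting variables \<open>x\<^sub>1, x\<^sub>2, \<dots>\<close> are represented by their
  coefficient functions: the monomial \<open>x\<^sub>w\<close> corresponds to the list \<open>w\<close>.  Addition is
  pointwise (\<^theory>\<open>HOL-Library.Function_Algebras\<close>).
\<close>

type_synonym 'a ncseries = "nat list \<Rightarrow> 'a"

definition words :: "nat list set" where
  "words = lists {0<..}"

text \<open>Positions in a word are counted from 1.\<close>

definition letter :: "nat list \<Rightarrow> nat \<Rightarrow> nat" where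
  "letter w i = w ! (i - 1)"

text \<open>
  The possibly infinite formal sum of the monomials \<open>x\<^sub>w\<close> for \<open>w \<in> W\<close>: every word in \<open>W\<close> has
  coefficient 1, every other word has coefficient 0.
\<close>

definition monomial_sum :: "nat list set \<Rightarrow> 'a::comm_ring_1 ncseries" where
  "monomial_sum W = (\<lambda>u. of_bool (u \<in> W))"

definition power_sum_NCSym :: "nat \<Rightarrow> nat set set \<Rightarrow> 'a::comm_ring_1 ncseries" where
  "power_sum_NCSym n \<phi> = monomial_sum
     {w \<in> words. length w = n \<and> (\<forall>B\<in>\<phi>. \<forall>j\<in>B. \<forall>k\<in>B. letter w j = letter w k)}"

definition set_composition :: "nat \<Rightarrow> nat set list \<Rightarrow> bool" where
  "set_composition n \<Phi> \<longleftrightarrow>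
     (\<forall>B\<in>set \<Phi>. B \<noteq> {}) \<and>
     (\<forall>i<length \<Phi>. \<forall>j<length \<Phi>. i \<noteq> j \<longrightarrow> \<Phi> ! i \<inter> \<Phi> ! j = {}) \<and>
     \<Union>(set \<Phi>) = {1..n}"

definition sort_blocks :: "nat set list \<Rightarrow> nat set set" where
  "sort_blocks \<Phi> = set \<Phi>"

definition word_composition :: "nat list \<Rightarrow> nat set list" where
  "word_composition w =
     map (\<lambda>v. {i \<in> {1..length w}. letter w i = v}) (sorted_list_of_set (set w))"

definition monomial_NCQSym :: "nat set list \<Rightarrow> 'a::comm_ring_1 ncseries" where
  "monomial_NCQSym \<Phi> = monomial_sum {w \<in> words. word_composition w = \<Phi>}"

text \<open>Only used for finite nonempty disjoint sets.\<close>

definition block_greater :: "nat set \<Rightarrow> nat set \<Rightarrow> bool" where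
  "block_greater A B \<longleftrightarrow> card A > card B \<or> (card A = card B \<and> Min A < Min B)"

text \<open>
  A matrix with exactly one block per row is stored as the list of its rows, where row \<open>i\<close> is given
  by its block together with the column (counted from 1) that contains it.  Lists are indexed from
  0, so \<open>F ! 0\<close> is the first row.
\<close>

type_synonym filling = "(nat set \<times> nat) list"

definition LDD :: "nat set list \<Rightarrow> filling set" where
  "LDD \<Phi> = {F. map fst F = \<Phi> \<and>
     (F \<noteq> [] \<longrightarrow> snd (F ! 0) = 1) \<and>
     (\<forall>i. Suc i < length F \<longrightarrow>
        (if block_greater (fst (F ! i)) (fst (F ! Suc i))
         then snd (F ! Suc i) = snd (F ! i) \<or> snd (F ! Suc i) = snd (F ! i) + 1
         else snd (F ! Suc i) = snd (F ! i) + 1))}"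

definition col :: "filling \<Rightarrow> nat set list" where
  "col F = map (\<lambda>c. \<Union>{B. (B, c) \<in> set F}) (sorted_list_of_set (snd ` set F))"

definition power_sum_NCQSym :: "nat set list \<Rightarrow> 'a::comm_ring_1 ncseries" where
  "power_sum_NCQSym \<Phi> = (\<Sum>F\<in>LDD \<Phi>. monomial_NCQSym (col F))"

end

theory Submission
  imports Defs "HOL-Library.Product_Lexorder"
begin

text \<open>
  Compare the coefficients of a monomial \<open>x\<^sub>u\<close>.  Sorting rows by column first and by the block order
  second, the fillings are exactly the strictly increasing lists whose set of columns is an initial
  segment \<open>{1..m}\<close>; hence a filling is determined by its set of pairs (block, column).  If
  \<open>col F = word_composition u\<close>, then a block \<open>B\<close> lies in column \<open>c\<close> precisely when \<open>u\<close> takes its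
  \<open>c\<close>-th smallest value on all of \<open>B\<close>.  So exactly one filling contributes to \<open>x\<^sub>u\<close> if \<open>u\<close> is
  constant on the blocks of \<open>\<phi>\<close>, and none otherwise.
\<close>

section \<open>Fillings as strictly increasing lists of rows\<close>

text \<open>The column is compared first. The cardinality is negated because larger blocks precede
  smaller ones in the block order, and the minimum breaks ties, so the lexicographic order on
  triples encodes the order on rows.\<close>

definition row_key :: "nat set \<times> nat \<Rightarrow> nat \<times> int \<times> nat" where
  "row_key r = (snd r, - int (card (fst r)), Min (fst r))"

lemma row_key_less_iff:
  "row_key r < row_key s \<longleftrightarrow> snd r < snd s \<or> snd r = snd s \<and> block_greater (fst r) (fst s)"
  by (auto simp: row_key_def block_greater_def less_prod_def')

text \<open>The first row is in column 1 and each further row stays or advances by one column, so no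
  column is skipped. The empty filling gives \<open>m = 0\<close>.\<close>

lemma LDD_columns:
  assumes "F \<in> LDD \<Phi>"
  obtains m where "snd ` set F = {1..m}"
proof (cases "F = []")
  case True
  then have "snd ` set F = {1..0}" by simp
  then show thesis using that by blast
next
  case False
  \<comment> \<open>Induction over prefixes: the columns met so far are exactly those up to the last
    one. The bound \<open>1 \<le> snd (F ! k)\<close> serves the case where the column stays the
    same, since inserting \<open>c\<close> into \<open>{1..c}\<close> changes nothing only if
    \<open>1 \<le> c\<close>.\<close>
  have take: "snd ` set (take (Suc k) F) = {1..snd (F ! k)} \<and> 1 \<le> snd (F ! k)"
    if "k < length F" for k
    using that
  proof (induction k)
    case 0
    then have "take (Suc 0) F = [F ! 0]" by (simp add: take_Suc_conv_app_nth)
    moreover have "snd (F ! 0) = 1" using assms False by (simp add: LDD_def)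
    ultimately show ?case by simp
  next
    case (Suc k)
    have "snd (F ! Suc k) = snd (F ! k) \<or> snd (F ! Suc k) = snd (F ! k) + 1"
      using assms Suc.prems by (auto simp: LDD_def split: if_splits)
    moreover have "set (take (Suc (Suc k)) F) = insert (F ! Suc k) (set (take (Suc k) F))"
      using Suc.prems by (simp add: take_Suc_conv_app_nth[of "Suc k"])
    ultimately show ?case using Suc by (auto simp: atLeastAtMostSuc_conv)
  qed
  from False have "length F - 1 < length F" "Suc (length F - 1) = length F" by auto
  with take[of "length F - 1"] show thesis using that by simp
qed

text \<open>Consecutive rows suffice by transitivity: either the column advances, or it stays, which
  is allowed only if the block order decreases.\<close>

lemma LDD_sorted:
  assumes "F \<in> LDD \<Phi>"
  shows "sorted_wrt (<) (map row_key F)"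
proof -
  have "row_key (F ! i) < row_key (F ! Suc i)" if "Suc i < length F" for i
    using assms that unfolding row_key_less_iff by (auto simp: LDD_def split: if_splits)
  then show ?thesis by (simp add: sorted_wrt_iff_nth_Suc_transp)
qed

text \<open>Converse of the two preceding lemmas. Absence of gaps bounds each column step by one,
  and strictness of the keys forces \<open>block_greater\<close> whenever the column does not
  change.\<close>

lemma LDD_I:
  assumes sorted: "sorted_wrt (<) (map row_key F)" and cols: "snd ` set F = {1..m}"
  shows "F \<in> LDD (map fst F)"
proof -
  have less: "row_key (F ! i) < row_key (F ! j)" if "i < j" "j < length F" for i j
    using sorted that by (auto simp: sorted_wrt_iff_nth_less)
  have le: "snd (F ! i) \<le> snd (F ! j)" if "i \<le> j" "j < length F" for i j
    using less[of i j] that by (cases "i = j") (auto simp: row_key_less_iff)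
  have in_cols: "1 \<le> snd (F ! i) \<and> snd (F ! i) \<le> m" if "i < length F" for i
    using cols that by (metis atLeastAtMost_iff image_eqI nth_mem)
  have attained: "\<exists>j<length F. snd (F ! j) = c" if "1 \<le> c" "c \<le> m" for c
  proof -
    have "c \<in> snd ` set F" using cols that by simp
    then show ?thesis by (metis imageE in_set_conv_nth)
  qed
  have first: "snd (F ! 0) = 1" if "F \<noteq> []"
  proof -
    have "1 \<le> snd (F ! 0)" "snd (F ! 0) \<le> m" using in_cols[of 0] that by auto
    then obtain j where "j < length F" "snd (F ! j) = 1" using attained[of 1] by auto
    then show ?thesis using le[of 0 j] \<open>1 \<le> snd (F ! 0)\<close> by simp
  qed
  have step: "snd (F ! Suc i) \<le> snd (F ! i) + 1" if i: "Suc i < length F" for i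
  proof (rule ccontr)
    assume gap: "\<not> ?thesis"
    then obtain j where j: "j < length F" "snd (F ! j) = snd (F ! i) + 1"
      using attained[of "snd (F ! i) + 1"] in_cols[OF i] by auto
    \<comment> \<open>A row \<open>j\<close> in the skipped column has no place: by monotonicity it
      can come neither up to row \<open>i\<close> nor from row \<open>Suc i\<close> on.\<close>
    show False
      using le[of j i] le[of "Suc i" j] i j gap by (cases "j \<le> i") auto
  qed
  have "if block_greater (fst (F ! i)) (fst (F ! Suc i))
         then snd (F ! Suc i) = snd (F ! i) \<or> snd (F ! Suc i) = snd (F ! i) + 1
         else snd (F ! Suc i) = snd (F ! i) + 1" if "Suc i < length F" for i
    using step[OF that] less[of i "Suc i"] that by (auto simp: row_key_less_iff)
  with first show ?thesis unfolding LDD_def One_nat_def by blast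
qed

text \<open>A sum over an infinite set would be 0 by convention. Here there are at most as many
  columns as rows, which bounds all entries.\<close>

lemma finite_LDD: "finite (LDD \<Phi>)"
proof (rule finite_subset)
  show "LDD \<Phi> \<subseteq> {F. set F \<subseteq> set \<Phi> \<times> {1..length \<Phi>} \<and> length F = length \<Phi>}"
  proof
    fix F assume F: "F \<in> LDD \<Phi>"
    then have map: "map fst F = \<Phi>" by (simp add: LDD_def)
    then have len: "length F = length \<Phi>" by auto
    obtain m where m: "snd ` set F = {1..m}" using LDD_columns[OF F] .
    then have "m \<le> length F" using card_image_le[of "set F" snd] card_length[of F] by simp
    then have "snd ` set F \<subseteq> {1..length \<Phi>}" using m len by simp
    moreover have "fst ` set F \<subseteq> set \<Phi>" unfolding map[symmetric] by simp
    ultimately have "set F \<subseteq> set \<Phi> \<times> {1..length \<Phi>}" 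
      by (simp add: image_subset_iff subset_iff mem_Times_iff)
    then show "F \<in> {F. set F \<subseteq> set \<Phi> \<times> {1..length \<Phi>} \<and> length F = length \<Phi>}"
      using len by simp
  qed
  show "finite {F. set F \<subseteq> set \<Phi> \<times> {1..length \<Phi>} \<and> length F = length \<Phi>}"
    by (rule finite_lists_length_eq) simp
qed

text \<open>Nonempty disjoint blocks cannot repeat, and different blocks of a partition are
  disjoint. The index set of the outer sum thus becomes the set of orderings of \<phi>.\<close>

lemma set_composition_iff_distinct:
  assumes "partition_on {1..n} \<phi>"
  shows "set_composition n \<Phi> \<and> sort_blocks \<Phi> = \<phi> \<longleftrightarrow> distinct \<Phi> \<and> set \<Phi> = \<phi>"
proof (intro iffI)
  assume L: "set_composition n \<Phi> \<and> sort_blocks \<Phi> = \<phi>"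
  then have "distinct \<Phi>"
    unfolding distinct_conv_nth set_composition_def by (metis inf.idem nth_mem)
  with L show "distinct \<Phi> \<and> set \<Phi> = \<phi>" by (simp add: sort_blocks_def)
next
  assume R: "distinct \<Phi> \<and> set \<Phi> = \<phi>"
  have "\<Phi> ! i \<inter> \<Phi> ! j = {}" if "i < length \<Phi>" "j < length \<Phi>" "i \<noteq> j" for i j
    using R that assms by (metis disjointD distinct_conv_nth nth_mem partition_onD2)
  then show "set_composition n \<Phi> \<and> sort_blocks \<Phi> = \<phi>"
    using R assms by (auto simp: set_composition_def sort_blocks_def partition_on_def)
qed

section \<open>Rows prescribed by a word\<close>

text \<open>The only rows that a filling contributing to the monomial of \<open>u\<close> can have.
  Columns count from 1 and list positions from 0, hence the index \<open>c - 1\<close>. A block on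
  which \<open>u\<close> is not constant gets no row.\<close>

definition value_rows :: "nat set set \<Rightarrow> nat list \<Rightarrow> (nat set \<times> nat) set" where
  "value_rows \<phi> u = {(B, c). B \<in> \<phi> \<and> c \<in> {1..card (set u)} \<and>
     (\<forall>i\<in>B. letter u i = sorted_list_of_set (set u) ! (c - 1))}"

lemma sorted_values_inj:
  assumes "c \<in> {1..card (set u)}" "d \<in> {1..card (set u)}"
    and "sorted_list_of_set (set u) ! (c - 1) = sorted_list_of_set (set u) ! (d - 1)"
  shows "c = d"
proof -
  have "c - 1 = d - 1"
    using assms nth_eq_iff_index_eq[OF distinct_sorted_list_of_set[of "set u"], of "c - 1" "d - 1"]
    by auto
  then show ?thesis using assms by auto
qed

lemma col_eq:
  assumes "snd ` set F = {1..m}"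
  shows "col F = map (\<lambda>c. \<Union>{B. (B, c) \<in> set F}) [1..<Suc m]"
  unfolding col_def assms
  by (metis atLeastLessThanSuc_atLeastAtMost sorted_list_of_set_range)

lemma col_eq_word_composition_iff:
  assumes "snd ` set F = {1..m}"
  shows "col F = word_composition u \<longleftrightarrow> m = card (set u) \<and>
    (\<forall>c\<in>{1..m}. \<Union>{B. (B, c) \<in> set F} =
       {i \<in> {1..length u}. letter u i = sorted_list_of_set (set u) ! (c - 1)})"
proof -
  \<comment> \<open>Passage from list positions, counted from 0, to columns, counted from 1.\<close>
  have "(\<forall>k<m. P (Suc k)) \<longleftrightarrow> (\<forall>c\<in>{1..m}. P c)" for P :: "nat \<Rightarrow> bool"
    by (metis One_nat_def Suc_le_eq Suc_pred atLeastAtMost_iff le_add1 less_eq_Suc_le plus_1_eq_Suc)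
  from this[of "\<lambda>c. \<Union>{B. (B, c) \<in> set F} =
       {i \<in> {1..length u}. letter u i = sorted_list_of_set (set u) ! (c - 1)}"]
  show ?thesis
    unfolding col_eq[OF assms] word_composition_def list_eq_iff_nth_eq
    by (cases "m = card (set u)") (simp_all del: upt_Suc)
qed

lemma Union_word_composition: "\<Union>(set (word_composition u)) = {1..length u}"
  by (auto simp: word_composition_def letter_def)

lemma Union_col: "\<Union>(set (col F)) = \<Union>(fst ` set F)"
  by (force simp: col_def)

text \<open>The unions of all blocks on both sides give the length. Each block lies within the union
  of its column, which is a level set of \<open>u\<close>; this yields constancy and fixes the
  column.\<close>

lemma col_eq_word_compositionD:
  assumes part: "partition_on {1..n} \<phi>"
    and blocks: "fst ` set F = \<phi>" and cols: "snd ` set F = {1..m}"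
    and eq: "col F = word_composition u"
  shows "length u = n" "\<forall>B\<in>\<phi>. \<forall>j\<in>B. \<forall>k\<in>B. letter u j = letter u k" "set F = value_rows \<phi> u"
proof -
  have "{1..length u} = {1..n}"
    using Union_word_composition[of u] Union_col[of F] eq blocks partition_onD1[OF part] by simp
  then show "length u = n" by (metis card_atLeastAtMost diff_Suc_1)
  note col = iffD1[OF col_eq_word_composition_iff[OF cols] eq]
  have sub: "(B, c) \<in> value_rows \<phi> u" if "(B, c) \<in> set F" for B c
  proof -
    have c: "c \<in> {1..m}" using cols that by force
    moreover have "B \<in> \<phi>" using blocks that by force
    moreover have "B \<subseteq> {i \<in> {1..length u}. letter u i = sorted_list_of_set (set u) ! (c - 1)}"
      using col c that by blast
    ultimately show ?thesis using col by (auto simp: value_rows_def)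
  qed
  have col_of: "\<exists>c. (B, c) \<in> set F" if "B \<in> \<phi>" for B using blocks that by force
  show "\<forall>B\<in>\<phi>. \<forall>j\<in>B. \<forall>k\<in>B. letter u j = letter u k"
    using sub col_of by (fastforce simp: value_rows_def)
  show "set F = value_rows \<phi> u"
  proof (intro equalityI subrelI)
    fix B c assume Bc: "(B, c) \<in> value_rows \<phi> u"
    then have "B \<in> \<phi>" by (simp add: value_rows_def)
    \<comment> \<open>\<open>B\<close> already has some column \<open>d\<close> in \<open>F\<close>;
      any element of \<open>B\<close> shows that \<open>c\<close> and \<open>d\<close> name the same
      value of \<open>u\<close>.\<close>
    then obtain d i where d: "(B, d) \<in> set F" and i: "i \<in> B"
      using col_of partition_onD3[OF part] by (metis ex_in_conv)
    have "c = d"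
      using Bc sub[OF d] i by (intro sorted_values_inj[of c u d]) (auto simp: value_rows_def)
    then show "(B, c) \<in> set F" using d by simp
  qed (rule sub)
qed

section \<open>The unique filling of a word\<close>

context
  fixes n :: nat and \<phi> :: "nat set set" and u :: "nat list"
  assumes part: "partition_on {1..n} \<phi>"
begin

lemma value_rows_functional:
  assumes "(B, c) \<in> value_rows \<phi> u" "(B, d) \<in> value_rows \<phi> u"
  shows "c = d"
proof -
  have "B \<noteq> {}" using assms partition_onD3[OF part] by (auto simp: value_rows_def)
  then show ?thesis
    using assms by (intro sorted_values_inj[of c u d]) (auto simp: value_rows_def)
qed

lemma inj_on_fst_value_rows: "inj_on fst (value_rows \<phi> u)"
  by (auto intro!: inj_onI dest: value_rows_functional)

text \<open>Equal keys give a common minimum, which lies in both blocks; blocks of a partition that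
  meet are equal.\<close>

lemma inj_on_row_key: "inj_on row_key (value_rows \<phi> u)"
proof (rule inj_onI)
  fix r s assume rs: "r \<in> value_rows \<phi> u" "s \<in> value_rows \<phi> u" "row_key r = row_key s"
  have Min: "Min (fst t) \<in> fst t" "fst t \<in> \<phi>" if "t \<in> value_rows \<phi> u" for t
  proof -
    show t: "fst t \<in> \<phi>" using that by (auto simp: value_rows_def)
    have "fst t \<subseteq> {1..n}" using t partition_onD1[OF part] by blast
    then have "finite (fst t)" by (rule finite_subset) simp
    moreover have "fst t \<noteq> {}" using t partition_onD3[OF part] by metis
    ultimately show "Min (fst t) \<in> fst t" by simp
  qed
  have "fst r \<inter> fst s \<noteq> {}" using Min[OF rs(1)] Min[OF rs(2)] rs(3) by (auto simp: row_key_def)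
  then have "fst r = fst s"
    using Min[OF rs(1)] Min[OF rs(2)] disjointD[OF partition_onD2[OF part]] by blast
  then show "r = s" using rs(3) by (simp add: row_key_def prod_eq_iff)
qed

lemma finite_value_rows: "finite (value_rows \<phi> u)"
proof -
  have "finite \<phi>" using part by (rule finite_elements[rotated]) simp
  moreover have "value_rows \<phi> u \<subseteq> \<phi> \<times> {1..card (set u)}" by (auto simp: value_rows_def)
  ultimately show ?thesis by (meson finite_SigmaI finite_atLeastAtMost finite_subset)
qed

text \<open>A strictly increasing list of keys is determined by its set, and injectivity of the key
  carries this over to rows.\<close>

lemma sorted_filling_unique:
  assumes "set F = value_rows \<phi> u" "set G = value_rows \<phi> u"
    and "sorted_wrt (<) (map row_key F)" "sorted_wrt (<) (map row_key G)"
  shows "F = G"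
proof -
  have "map row_key F = map row_key G"
    using assms by (intro strict_sorted_equal) (auto simp del: sorted_wrt_map)
  then show ?thesis
    using assms inj_on_row_key by (metis inj_on_map_eq_map sup.idem)
qed

lemma sorted_filling_exists:
  obtains F where "set F = value_rows \<phi> u" "sorted_wrt (<) (map row_key F)" "distinct (map fst F)"
proof -
  obtain xs where xs: "set xs = value_rows \<phi> u" "distinct xs"
    using finite_distinct_list[OF finite_value_rows] by blast
  let ?F = "sort_key row_key xs"
  have "set ?F = value_rows \<phi> u" using xs by simp
  moreover have "sorted_wrt (<) (map row_key ?F)"
    unfolding strict_sorted_iff using xs inj_on_row_key by (simp add: distinct_map)
  moreover have "distinct (map fst ?F)" using xs inj_on_fst_value_rows by (simp add: distinct_map)
  ultimately show thesis using that by blast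
qed

context
  assumes len: "length u = n"
    and const: "\<forall>B\<in>\<phi>. \<forall>j\<in>B. \<forall>k\<in>B. letter u j = letter u k"
begin

lemma block_in_value_rows:
  assumes "B \<in> \<phi>" "i \<in> B"
  obtains c where "(B, c) \<in> value_rows \<phi> u" "letter u i = sorted_list_of_set (set u) ! (c - 1)"
proof -
  have "i \<in> {1..n}" using assms partition_onD1[OF part] by blast
  then have "letter u i \<in> set u" using len by (auto simp: letter_def)
  then obtain k where k: "k < card (set u)" "sorted_list_of_set (set u) ! k = letter u i"
    by (metis List.finite_set in_set_conv_nth length_sorted_list_of_set set_sorted_list_of_set)
  moreover have "letter u j = letter u i" if "j \<in> B" for j
    using const assms that by metis
  \<comment> \<open>The value of \<open>u\<close> on \<open>B\<close> has position \<open>k\<close>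
    among the sorted values, so the column is \<open>Suc k\<close>.\<close>
  ultimately have "(B, Suc k) \<in> value_rows \<phi> u" using assms(1) by (simp add: value_rows_def)
  then show thesis using that[of "Suc k"] k by simp
qed

lemma fst_value_rows: "fst ` value_rows \<phi> u = \<phi>"
proof (intro equalityI subsetI)
  fix B assume "B \<in> \<phi>"
  moreover from this obtain i where "i \<in> B" using partition_onD3[OF part] by fastforce
  ultimately obtain c where "(B, c) \<in> value_rows \<phi> u" by (rule block_in_value_rows)
  then show "B \<in> fst ` value_rows \<phi> u" by force
qed (auto simp: value_rows_def)

lemma Union_value_rows_column:
  assumes c: "c \<in> {1..card (set u)}"
  shows "\<Union>{B. (B, c) \<in> value_rows \<phi> u} =
    {i \<in> {1..length u}. letter u i = sorted_list_of_set (set u) ! (c - 1)}"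
proof (intro equalityI subsetI)
  fix i assume "i \<in> {i \<in> {1..length u}. letter u i = sorted_list_of_set (set u) ! (c - 1)}"
  then have i: "i \<in> {1..n}" "letter u i = sorted_list_of_set (set u) ! (c - 1)"
    using len by auto
  then obtain B where B: "B \<in> \<phi>" "i \<in> B" using partition_onD1[OF part] by blast
  then obtain d where d: "(B, d) \<in> value_rows \<phi> u"
    "letter u i = sorted_list_of_set (set u) ! (d - 1)" by (rule block_in_value_rows)
  have "c = d" using c d i by (intro sorted_values_inj[of c u d]) (auto simp: value_rows_def)
  then show "i \<in> \<Union>{B. (B, c) \<in> value_rows \<phi> u}" using d B by blast
next
  fix i assume "i \<in> \<Union>{B. (B, c) \<in> value_rows \<phi> u}"
  then show "i \<in> {i \<in> {1..length u}. letter u i = sorted_list_of_set (set u) ! (c - 1)}"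
    using partition_onD1[OF part] len by (auto simp: value_rows_def)
qed

text \<open>Every value of \<open>u\<close> occurs at some position, and the block containing that
  position occupies the corresponding column. This is the absence of gaps that \<open>LDD_I\<close>
  requires.\<close>

lemma snd_value_rows: "snd ` value_rows \<phi> u = {1..card (set u)}"
proof (intro equalityI subsetI)
  fix c assume c: "c \<in> {1..card (set u)}"
  then have "c - 1 < length (sorted_list_of_set (set u))" by auto
  then have "sorted_list_of_set (set u) ! (c - 1) \<in> set u"
    by (metis List.finite_set nth_mem set_sorted_list_of_set)
  then obtain k where "k < length u" "u ! k = sorted_list_of_set (set u) ! (c - 1)"
    by (auto simp: in_set_conv_nth)
  then have "Suc k \<in> {i \<in> {1..length u}. letter u i = sorted_list_of_set (set u) ! (c - 1)}"
    by (simp add: letter_def)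
  then obtain B where "(B, c) \<in> value_rows \<phi> u"
    unfolding Union_value_rows_column[OF c, symmetric] by blast
  then show "c \<in> snd ` value_rows \<phi> u" by force
qed (auto simp: value_rows_def)

text \<open>Stated as an equivalence with one fixed pair, so that it both evaluates each summand and
  shows that the pair belongs to the index set.\<close>

lemma ex1_contributing_filling:
  "\<exists>F. \<forall>\<Phi> G. distinct \<Phi> \<and> set \<Phi> = \<phi> \<and> G \<in> LDD \<Phi> \<and> word_composition u = col G \<longleftrightarrow>
     (\<Phi>, G) = (map fst F, F)"
proof -
  obtain F where F: "set F = value_rows \<phi> u" "sorted_wrt (<) (map row_key F)"
    "distinct (map fst F)" by (rule sorted_filling_exists)
  have cols: "snd ` set F = {1..card (set u)}" using F snd_value_rows by simp
  have "F \<in> LDD (map fst F)" using F(2) cols by (rule LDD_I)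
  moreover have "set (map fst F) = \<phi>" using F fst_value_rows by simp
  moreover have "col F = word_composition u"
    unfolding col_eq_word_composition_iff[OF cols] using Union_value_rows_column F(1) by simp
  moreover have "\<Phi> = map fst F \<and> G = F"
    if G: "set \<Phi> = \<phi>" "G \<in> LDD \<Phi>" "word_composition u = col G" for \<Phi> G
  proof -
    have \<Phi>: "\<Phi> = map fst G" using G by (simp add: LDD_def)
    obtain m where "snd ` set G = {1..m}" using LDD_columns[OF G(2)] .
    then have "set G = value_rows \<phi> u"
      using G \<Phi> by (intro col_eq_word_compositionD(3)[OF part]) auto
    then have "G = F" using F LDD_sorted[OF G(2)] by (intro sorted_filling_unique)
    then show ?thesis using \<Phi> by simp
  qed
  ultimately have "distinct \<Phi> \<and> set \<Phi> = \<phi> \<and> G \<in> LDD \<Phi> \<and> word_composition u = col G \<longleftrightarrow>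
      (\<Phi>, G) = (map fst F, F)" for \<Phi> G
    using F(3) by (metis prod.inject)
  then show ?thesis by blast
qed

end

end

section \<open>Comparison of coefficients\<close>

lemma sum_fun_apply: "(\<Sum>x\<in>A. f x) u = (\<Sum>x\<in>A. f x u)"
  for f :: "'b \<Rightarrow> 'c \<Rightarrow> 'a::comm_monoid_add"
  by (induction A rule: infinite_finite_induct) auto

theorem theorem4p5:
  fixes n :: nat and \<phi> :: "nat set set"
  assumes "partition_on {1..n} \<phi>"
  shows "(power_sum_NCSym n \<phi> :: 'a::comm_ring_1 ncseries) =
    (\<Sum>\<Phi> | set_composition n \<Phi> \<and> sort_blocks \<Phi> = \<phi>. power_sum_NCQSym \<Phi>)"
proof
  fix u :: "nat list"
  let ?S = "{\<Phi>. distinct \<Phi> \<and> set \<Phi> = \<phi>}"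
  let ?P = "\<lambda>F. u \<in> words \<and> word_composition u = col F"
  define C where "C \<longleftrightarrow> u \<in> words \<and> length u = n \<and>
    (\<forall>B\<in>\<phi>. \<forall>j\<in>B. \<forall>k\<in>B. letter u j = letter u k)"
  have coeff: "power_sum_NCSym n \<phi> u = (of_bool C :: 'a)"
    unfolding power_sum_NCSym_def monomial_sum_def C_def mem_Collect_eq ..
  have "finite \<phi>" using assms by (rule finite_elements[rotated]) simp
  then have finS: "finite ?S"
    by (rule finite_subset[OF _ finite_subset_distinct[of \<phi>], rotated]) auto
  have "(\<Sum>\<Phi> | set_composition n \<Phi> \<and> sort_blocks \<Phi> = \<phi>. power_sum_NCQSym \<Phi>) u =
      (\<Sum>\<Phi>\<in>?S. \<Sum>F\<in>LDD \<Phi>. of_bool (?P F) :: 'a)"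
    by (simp add: set_composition_iff_distinct[OF assms] sum_fun_apply power_sum_NCQSym_def
        monomial_NCQSym_def monomial_sum_def)
  \<comment> \<open>The double sum becomes one sum over pairs of a composition and a filling, of
    which at most one contributes.\<close>
  also have "\<dots> = (\<Sum>p\<in>Sigma ?S LDD. of_bool (?P (snd p)))"
    using finS by (subst sum.Sigma) (auto simp: finite_LDD case_prod_beta)
  also have "\<dots> = power_sum_NCSym n \<phi> u"
  proof (cases C)
    case True
    then obtain F where F: "\<And>\<Phi> G. distinct \<Phi> \<and> set \<Phi> = \<phi> \<and> G \<in> LDD \<Phi> \<and>
        word_composition u = col G \<longleftrightarrow> (\<Phi>, G) = (map fst F, F)"
      using ex1_contributing_filling[OF assms, of u] unfolding C_def by blast
    have "(\<Sum>p\<in>Sigma ?S LDD. of_bool (?P (snd p)) :: 'a) =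
        (\<Sum>p\<in>Sigma ?S LDD. if p = (map fst F, F) then 1 else 0)"
    proof (rule sum.cong)
      fix p assume "p \<in> Sigma ?S LDD"
      then show "of_bool (?P (snd p)) = (if p = (map fst F, F) then 1 else 0 :: 'a)"
        using F[of "fst p" "snd p"] True unfolding C_def by (cases p) auto
    qed simp
    also have "\<dots> = 1"
      using F[of "map fst F" F] finS by (subst sum.delta) (auto simp: finite_LDD)
    finally show ?thesis using True coeff by simp
  next
    case False
    \<comment> \<open>A single contributing pair would already force the length and the constancy on
      blocks, that is, \<open>C\<close>.\<close>
    have "\<not> ?P (snd p)" if p: "p \<in> Sigma ?S LDD" for p
    proof
      assume P: "?P (snd p)"
      obtain \<Phi> F where F: "p = (\<Phi>, F)" "set \<Phi> = \<phi>" "F \<in> LDD \<Phi>" using p by blast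
      obtain m where m: "snd ` set F = {1..m}" using LDD_columns[OF F(3)] .
      have "map fst F = \<Phi>" using F(3) by (simp add: LDD_def)
      then have blocks: "fst ` set F = \<phi>" using F(2) by (metis set_map)
      have eq: "u \<in> words" "col F = word_composition u" using P F(1) by simp_all
      have C
        unfolding C_def
        by (intro conjI eq(1) col_eq_word_compositionD(1,2)[OF assms blocks m eq(2)])
      with False show False ..
    qed
    then have "(\<Sum>p\<in>Sigma ?S LDD. of_bool (?P (snd p)) :: 'a) = 0"
      by (intro sum.neutral ballI) (subst of_bool_eq_0_iff, blast)
    then show ?thesis using False coeff by simp
  qed
  finally show "power_sum_NCSym n \<phi> u =
    (\<Sum>\<Phi> | set_composition n \<Phi> \<and> sort_blocks \<Phi> = \<phi>. power_sum_NCQSym \<Phi> :: 'a ncseries) u" ..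
qed

end
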